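(* Let $F=\{e_1,\ldots,e_p\}\subseteq E(K_n)$ be a set of $p\ge 1$ distinct edges of the complete graph $K_n$, and assume that $G=K_n-F$ is connected. Let $B$ be an oriented incidence matrix of $F$ and let $Q=B^TB$ be the edge-defect matrix. For two distinct vertices $x,y\in V(G)$, put $\eta_{xy}=B^T(e_x-e_y)\in\mathbb{R}^p$. Then $$R_G(x,y)=\frac{2}{n}+\frac{1}{n}\,\eta_{xy}^T\,(nI_p-Q)^{-1}\,\eta_{xy}.$$
   Context: $K_n$ is the complete graph on $n$ vertices and $K_n-F$ is the graph on the same $n$ vertices obtained by deleting the edges in $F$. For a vertex $x$, $e_x\in\mathbb{R}^n$ denotes the standard basis vector indexed by $x$ (not to be confused with the edges $e_\alpha$). For each deleted edge $e_\alpha=\{u_\alpha,v_\alpha\}$ choose an arbitrary orientation and put $b_\alpha=e_{u_\alpha}-e_{v_\alpha}\in\mathbb{R}^n$; the incidence matrix of $F$ is the $n\times p$ matrix $B=[\,b_1\ \cdots\ b_p\,]$, and the edge-defect matrix of $F$ is the $p\times p$ matrix $Q=B^TB$. For a connected graph $G$ with Laplacian matrix $L(G)=D(G)-A(G)$ (degree matrix minus adjacency matrix), the effective resistance between distinct vertices $x,y$ is $R_G(x,y)=(e_x-e_y)^TL(G)^+(e_x-e_y)$, where $L(G)^+$ is the Moore--Penrose inverse. *)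

theory Defs
  imports "HOL-Analysis.Analysis"
begin

text \<open>A simple graph on the vertex set \<open>UNIV :: 'v set\<close> is given by its set of edges, each edge
  being a two-element set of vertices.\<close>

type_synonym 'v edges = "'v set set"

definition complete_edges :: "'v edges" where
  "complete_edges = {{x, y} | x y. x \<noteq> y}"

definition graph_connected :: "'v edges \<Rightarrow> bool" where
  "graph_connected E \<longleftrightarrow> (\<forall>x y. (x, y) \<in> {(a, b). {a, b} \<in> E}\<^sup>*)"

definition adjacency_matrix :: "'v::finite edges \<Rightarrow> real ^ 'v ^ 'v" where
  "adjacency_matrix E = (\<chi> x y. if {x, y} \<in> E then 1 else 0)"

definition degree_matrix :: "'v::finite edges \<Rightarrow> real ^ 'v ^ 'v" where
  "degree_matrix E = (\<chi> x y. if x = y then real (card {e \<in> E. x \<in> e}) else 0)"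

definition laplacian_matrix :: "'v::finite edges \<Rightarrow> real ^ 'v ^ 'v" where
  "laplacian_matrix E = degree_matrix E - adjacency_matrix E"

text \<open>The four Penrose equations determine \<open>X\<close> uniquely, and every real matrix \<open>A\<close> admits
  such an \<open>X\<close>.\<close>

definition is_moore_penrose_inverse :: "real ^ 'n ^ 'm \<Rightarrow> real ^ 'm ^ 'n \<Rightarrow> bool" where
  "is_moore_penrose_inverse A X \<longleftrightarrow>
     A ** X ** A = A \<and>
     X ** A ** X = X \<and>
     transpose (A ** X) = A ** X \<and>
     transpose (X ** A) = X ** A"

definition moore_penrose_inverse :: "real ^ 'n ^ 'm \<Rightarrow> real ^ 'm ^ 'n" where
  "moore_penrose_inverse A = (THE X. is_moore_penrose_inverse A X)"

definition effective_resistance :: "'v::finite edges \<Rightarrow> 'v \<Rightarrow> 'v \<Rightarrow> real" where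
  "effective_resistance E x y =
     (axis x 1 - axis y 1) \<bullet> (moore_penrose_inverse (laplacian_matrix E) *v (axis x 1 - axis y 1))"

text \<open>A family of edges indexed by \<open>'p\<close> with a chosen orientation is given by its end points
  \<open>u \<alpha>\<close> and \<open>v \<alpha>\<close>. Rows of the incidence matrix are indexed by vertices and columns by edges.\<close>

definition incidence_matrix :: "('p::finite \<Rightarrow> 'v::finite) \<Rightarrow> ('p \<Rightarrow> 'v) \<Rightarrow> real ^ 'p ^ 'v" where
  "incidence_matrix u v = (\<chi> i \<alpha>. (axis (u \<alpha>) 1 - axis (v \<alpha>) 1) $ i)"

definition edge_defect_matrix :: "real ^ 'p ^ 'v \<Rightarrow> real ^ 'p ^ 'p" where
  "edge_defect_matrix B = transpose B ** B"

end

theory Submission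
  imports Defs
begin

text \<open>With \<open>J\<close> the all-ones matrix, the Laplacian of \<open>G = K\<^sub>n - F\<close> is \<open>L = n I - J - B B\<^sup>T\<close>. If
  \<open>(n I - Q) z = 0\<close>, then \<open>L (B z) = 0\<close>; as \<open>G\<close> is connected, \<open>B z\<close> is constant, and since it also
  sums to zero it vanishes, whence \<open>z = 0\<close>. So \<open>S = (n I - Q)\<^sup>-\<^sup>1\<close> exists, and because
  \<open>J B = 0\<close> one computes \<open>L (I - J/n + B S B\<^sup>T) = n I - J\<close>. Hence
  \<open>L\<^sup>+ = (I - J/n + B S B\<^sup>T) / n\<close>, which is evaluated at \<open>e\<^sub>x - e\<^sub>y\<close>.\<close>

section \<open>Matrices\<close>

lemma matrix_add_rdistrib:
  fixes A B :: "'a::semiring_1 ^ 'n ^ 'm" and C :: "'a ^ 'k ^ 'n"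
  shows "(A + B) ** C = A ** C + B ** C"
  by (simp add: matrix_matrix_mult_def vec_eq_iff sum.distrib distrib_right)

lemma matrix_diff_ldistrib:
  fixes A :: "'a::ring_1 ^ 'n ^ 'm" and B C :: "'a ^ 'k ^ 'n"
  shows "A ** (B - C) = A ** B - A ** C"
  by (simp add: matrix_matrix_mult_def vec_eq_iff sum_subtractf right_diff_distrib)

lemma matrix_diff_rdistrib:
  fixes A B :: "'a::ring_1 ^ 'n ^ 'm" and C :: "'a ^ 'k ^ 'n"
  shows "(A - B) ** C = A ** C - B ** C"
  by (simp add: matrix_matrix_mult_def vec_eq_iff sum_subtractf left_diff_distrib)

lemma matrix_zero_left: "(0 :: 'a::semiring_1 ^ 'n ^ 'm) ** (C :: 'a ^ 'k ^ 'n) = 0"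
  by (simp add: matrix_matrix_mult_def vec_eq_iff)

lemma matrix_zero_right: "(C :: 'a::semiring_1 ^ 'n ^ 'm) ** (0 :: 'a ^ 'k ^ 'n) = 0"
  by (simp add: matrix_matrix_mult_def vec_eq_iff)

lemma matrix_scaleR_right:
  fixes A :: "real ^ 'n ^ 'm" and B :: "real ^ 'k ^ 'n"
  shows "A ** (c *\<^sub>R B) = c *\<^sub>R (A ** B)"
  by (simp add: matrix_scalar_ac scalar_matrix_assoc)

lemma matrix_scaleR_left:
  fixes A :: "real ^ 'n ^ 'm" and B :: "real ^ 'k ^ 'n"
  shows "(c *\<^sub>R A) ** B = c *\<^sub>R (A ** B)"
  by (simp add: scalar_matrix_assoc)

lemmas matrix_mult_bilinear = matrix_add_ldistrib matrix_add_rdistrib matrix_diff_ldistrib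
  matrix_diff_rdistrib matrix_zero_left matrix_zero_right matrix_scaleR_left matrix_scaleR_right

lemma transpose_add: "transpose (A + B) = transpose A + transpose B"
  by (simp add: transpose_def vec_eq_iff)

lemma transpose_diff: "transpose (A - B) = transpose A - transpose B"
  by (simp add: transpose_def vec_eq_iff)

lemma transpose_zero: "transpose 0 = 0"
  by (simp add: transpose_def vec_eq_iff)

text \<open>Transposing \<open>A ** S = mat 1\<close> makes \<open>transpose S\<close> a left
  inverse of \<open>A\<close>, and a left inverse agrees with the right inverse
  \<open>S\<close>.\<close>

lemma symmetric_left_right_inverse:
  fixes A S :: "'a::comm_ring_1 ^ 'n ^ 'n"
  assumes "transpose A = A" and "A ** S = mat 1" and "S ** A = mat 1"
  shows "transpose S = S"
proof -
  have "transpose S ** A = mat 1"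
    using matrix_transpose_mul[of A S] by (simp only: assms(1,2) transpose_mat)
  then have "transpose S ** A ** S = S"
    by simp
  then show ?thesis
    by (simp add: matrix_mul_assoc[symmetric] assms(2))
qed

text \<open>If \<open>X\<close> and \<open>Y\<close> both satisfy the Penrose equations,
  \<open>A ** X\<close> and \<open>A ** Y\<close> are both the orthogonal projection onto the column
  space of \<open>A\<close>, so they coincide; likewise \<open>X ** A\<close> and
  \<open>Y ** A\<close>. Then Y = Y A Y = X A Y = X A X = X.\<close>

lemma moore_penrose_inverse_eqI:
  assumes "is_moore_penrose_inverse A X"
  shows "moore_penrose_inverse A = X"
  unfolding moore_penrose_inverse_def
proof (rule the_equality)
  fix Y
  assume Y: "is_moore_penrose_inverse A Y"
  have X: "A ** X ** A = A" "X ** A ** X = X" "transpose (A ** X) = A ** X"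
      "transpose (X ** A) = X ** A"
    and Y: "A ** Y ** A = A" "Y ** A ** Y = Y" "transpose (A ** Y) = A ** Y"
      "transpose (Y ** A) = Y ** A"
    using assms Y by (simp_all add: is_moore_penrose_inverse_def)
  have "A ** Y = transpose (A ** X ** (A ** Y))"
    by (simp add: matrix_mul_assoc X(1) Y(3))
  also have "\<dots> = A ** Y ** (A ** X)"
    by (simp only: matrix_transpose_mul[of "A ** X"] X(3) Y(3))
  also have "\<dots> = A ** X"
    by (simp add: matrix_mul_assoc Y(1))
  finally have AXY: "A ** Y = A ** X" .
  have "Y ** A = transpose (Y ** A ** (X ** A))"
    using X(1) Y(4) by (simp add: matrix_mul_assoc[symmetric])
  also have "\<dots> = X ** A ** (Y ** A)"
    by (simp only: matrix_transpose_mul[of "Y ** A"] X(4) Y(4))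
  also have "\<dots> = X ** A"
    using Y(1) by (simp add: matrix_mul_assoc[symmetric])
  finally have YXA: "Y ** A = X ** A" .
  have "Y = Y ** A ** Y"
    by (simp only: Y(2))
  also have "\<dots> = X ** (A ** Y)"
    by (simp only: YXA matrix_mul_assoc)
  also have "\<dots> = X"
    by (simp only: AXY matrix_mul_assoc X(2))
  finally show "Y = X" .
qed (fact assms)

section \<open>The pseudoinverse of n I - J - B B^T\<close>

abbreviation ones_matrix :: "real ^ 'n ^ 'm" where
  "ones_matrix \<equiv> (\<chi> i j. 1)"

text \<open>Pure matrix algebra from J B = 0: the products of the two matrices in either order equal
  I - J/n, the orthogonal projection onto the vectors with entry sum zero.\<close>

lemma is_moore_penrose_inverse_complement:
  fixes B :: "real ^ 'p::finite ^ 'v::finite" and S :: "real ^ 'p ^ 'p"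
  defines "n \<equiv> real CARD('v)" and "J \<equiv> ones_matrix :: real ^ 'v ^ 'v"
  assumes JB: "J ** B = 0"
    and KS: "(n *\<^sub>R mat 1 - transpose B ** B) ** S = mat 1"
    and SK: "S ** (n *\<^sub>R mat 1 - transpose B ** B) = mat 1"
  shows "is_moore_penrose_inverse (n *\<^sub>R mat 1 - J - B ** transpose B)
    ((1 / n) *\<^sub>R (mat 1 - (1 / n) *\<^sub>R J + B ** S ** transpose B))"
proof -
  define L where "L = n *\<^sub>R mat 1 - J - B ** transpose B"
  define Y where "Y = mat 1 - (1 / n) *\<^sub>R J + B ** S ** transpose B"
  have n: "n > 0"
    by (simp add: n_def)
  have J_sym: "transpose J = J"
    by (simp add: J_def transpose_def vec_eq_iff)
  have JJ: "J ** J = n *\<^sub>R J"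
    by (simp add: J_def n_def matrix_matrix_mult_def vec_eq_iff)
  have BJ: "transpose B ** J = 0"
    using matrix_transpose_mul[of J B] by (simp only: JB J_sym transpose_zero)
  have S_sym: "transpose S = S"
    by (rule symmetric_left_right_inverse[OF _ KS SK])
       (simp add: transpose_diff transpose_scalar matrix_transpose_mul)
  have L_sym: "transpose L = L"
    by (simp add: L_def transpose_diff transpose_scalar matrix_transpose_mul J_sym)
  have Y_sym: "transpose Y = Y"
    by (simp add: Y_def transpose_add transpose_diff transpose_scalar matrix_transpose_mul J_sym S_sym
        matrix_mul_assoc)
  have JY: "J ** Y = 0"
    using n by (simp add: Y_def matrix_mult_bilinear JJ matrix_mul_assoc JB)
  have JL: "J ** L = 0"
    by (simp add: L_def matrix_mult_bilinear JJ matrix_mul_assoc JB)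
  \<comment> \<open>This is K S = I for K = n I - B^T B, solved for B^T B S. It makes B^T Y
    collapse: B^T + (n S - I) B^T = n S B^T.\<close>
  have QS: "transpose B ** B ** S = n *\<^sub>R S - mat 1"
    using KS by (simp add: matrix_mult_bilinear algebra_simps)
  have BY: "transpose B ** Y = n *\<^sub>R (S ** transpose B)"
    by (simp add: Y_def matrix_mult_bilinear BJ matrix_mul_assoc QS)
  have "L ** Y = n *\<^sub>R Y - B ** (transpose B ** Y)"
    by (simp add: L_def matrix_mult_bilinear JY matrix_mul_assoc)
  \<comment> \<open>The summand n B S B^T of n Y cancels against B (B^T Y).\<close>
  also have "\<dots> = n *\<^sub>R mat 1 - J"
    unfolding BY using n by (simp add: Y_def matrix_mult_bilinear matrix_mul_assoc algebra_simps)
  finally have LY: "L ** Y = n *\<^sub>R mat 1 - J" .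
  have "Y ** L = transpose (L ** Y)"
    by (simp only: matrix_transpose_mul L_sym Y_sym)
  then have YL: "Y ** L = n *\<^sub>R mat 1 - J"
    by (simp add: LY transpose_diff transpose_scalar J_sym)
  have "L ** ((1 / n) *\<^sub>R Y) = mat 1 - (1 / n) *\<^sub>R J" "((1 / n) *\<^sub>R Y) ** L = mat 1 - (1 / n) *\<^sub>R J"
    using n by (simp_all add: matrix_mult_bilinear LY YL algebra_simps)
  \<comment> \<open>I - J/n is symmetric, which gives two Penrose equations. It fixes
    \<open>L\<close> and \<open>Y\<close> from the left because J L = 0 and J Y = 0, which gives the
    other two.\<close>
  then show ?thesis
    unfolding is_moore_penrose_inverse_def L_def[symmetric] Y_def[symmetric]
    by (simp add: matrix_mult_bilinear JL JY transpose_diff transpose_scalar J_sym)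
qed

section \<open>Graphs\<close>

text \<open>Every edge through \<open>i\<close> has the form {i, j}, and distinct \<open>j\<close>
  give distinct edges. This serves both for degrees in the Laplacian and for counting the deleted
  edges at a vertex.\<close>

lemma card_incident_edges:
  fixes E :: "'v::finite edges"
  assumes "E \<subseteq> complete_edges"
  shows "card {e \<in> E. i \<in> e} = card {j. {i, j} \<in> E}"
proof -
  have "{e \<in> E. i \<in> e} = (\<lambda>j. {i, j}) ` {j. {i, j} \<in> E}"
    using assms by (force simp: complete_edges_def insert_commute)
  moreover have "inj_on (\<lambda>j. {i, j}) {j. {i, j} \<in> E}"
    by (auto simp: inj_on_def doubleton_eq_iff)
  ultimately show ?thesis
    by (simp add: card_image)
qed

lemma laplacian_matrix_mult_vec:
  fixes E :: "'v::finite edges"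
  assumes "E \<subseteq> complete_edges"
  shows "(laplacian_matrix E *v w) $ i = (\<Sum>j | {i, j} \<in> E. w $ i - w $ j)"
proof -
  have deg: "(\<Sum>j\<in>UNIV. degree_matrix E $ i $ j * w $ j) = card {j. {i, j} \<in> E} * w $ i"
    by (simp add: degree_matrix_def card_incident_edges[OF assms] if_distrib[where f = "\<lambda>a. a * b" for b]
        cong: if_cong)
  have "(\<Sum>j\<in>UNIV. adjacency_matrix E $ i $ j * w $ j) = (\<Sum>j | {i, j} \<in> E. w $ j)"
    by (simp add: adjacency_matrix_def sum.If_cases if_distrib[where f = "\<lambda>a. a * b" for b]
        cong: if_cong)
  with deg show ?thesis
    by (simp add: laplacian_matrix_def matrix_vector_mult_def left_diff_distrib sum_subtractf)
qed

text \<open>Maximum principle: a maximum of \<open>w\<close> propagates along edges.\<close>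

lemma laplacian_matrix_kernel_constant:
  fixes E :: "'v::finite edges"
  assumes E: "E \<subseteq> complete_edges" and conn: "graph_connected E"
    and ker: "laplacian_matrix E *v w = 0"
  shows "w $ i = w $ j"
proof -
  define m where "m = Max (range (($) w))"
  have le: "w $ k \<le> m" for k
    by (simp add: m_def)
  have "m \<in> range (($) w)"
    unfolding m_def by (rule Max_in) auto
  then obtain a where a: "w $ a = m"
    by auto
  have step: "w $ c = m" if "w $ b = m" "{b, c} \<in> E" for b c
  proof -
    have "(\<Sum>k | {b, k} \<in> E. w $ b - w $ k) = 0"
      using laplacian_matrix_mult_vec[OF E, of w b] ker by simp
    \<comment> \<open>At a maximum every summand is nonnegative, so a zero sum forces each one to
      vanish.\<close>
    then have "\<forall>k\<in>{k. {b, k} \<in> E}. w $ b - w $ k = 0"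
      by (subst (asm) sum_nonneg_eq_0_iff) (auto simp: that le)
    then show ?thesis
      using that by auto
  qed
  have "w $ k = m" for k
  proof -
    have "(a, k) \<in> {(b, c). {b, c} \<in> E}\<^sup>*"
      using conn by (simp add: graph_connected_def)
    then show ?thesis
      by induction (use a step in blast)+
  qed
  then show ?thesis
    by simp
qed

section \<open>Incidence matrix and Laplacian of the complement\<close>

lemma ones_matrix_mult_incidence_matrix:
  "(ones_matrix :: real ^ 'v ^ 'm) ** incidence_matrix u (v :: 'p::finite \<Rightarrow> 'v::finite) = 0"
  \<comment> \<open>Each column is a difference of two standard basis vectors, so its entries sum to
    zero.\<close>
  by (simp add: incidence_matrix_def matrix_matrix_mult_def vec_eq_iff sum_subtractf axis_def)

text \<open>Since u \<alpha> and v \<alpha> differ, the entries of row \<open>i\<close> are 1 or -1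
  at the edges through \<open>i\<close> and 0 elsewhere, so their squares count these edges.
  Injectivity turns the count of indices into a count of edges.\<close>

lemma incidence_matrix_mult_transpose_diagonal:
  fixes u v :: "'p::finite \<Rightarrow> 'v::finite"
  assumes F: "range (\<lambda>\<alpha>. {u \<alpha>, v \<alpha>}) \<subseteq> complete_edges" and inj: "inj (\<lambda>\<alpha>. {u \<alpha>, v \<alpha>})"
  shows "(incidence_matrix u v ** transpose (incidence_matrix u v)) $ i $ i =
    card {j. {i, j} \<in> range (\<lambda>\<alpha>. {u \<alpha>, v \<alpha>})}"
proof -
  have uv: "u \<alpha> \<noteq> v \<alpha>" for \<alpha>
    using F by (auto simp: complete_edges_def doubleton_eq_iff)
  have "(incidence_matrix u v ** transpose (incidence_matrix u v)) $ i $ i =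
    (\<Sum>\<alpha>\<in>UNIV. if i \<in> {u \<alpha>, v \<alpha>} then 1 else 0)"
    unfolding matrix_matrix_mult_def transpose_def incidence_matrix_def
    using uv uv[symmetric] by (auto simp: axis_def intro!: sum.cong)
  also have "\<dots> = card {\<alpha>. i \<in> {u \<alpha>, v \<alpha>}}"
    by (simp add: sum.If_cases)
  also have "card {\<alpha>. i \<in> {u \<alpha>, v \<alpha>}} = card ((\<lambda>\<alpha>. {u \<alpha>, v \<alpha>}) ` {\<alpha>. i \<in> {u \<alpha>, v \<alpha>}})"
    by (rule card_image[symmetric]) (rule inj_on_subset[OF inj], simp)
  also have "(\<lambda>\<alpha>. {u \<alpha>, v \<alpha>}) ` {\<alpha>. i \<in> {u \<alpha>, v \<alpha>}} = {f \<in> range (\<lambda>\<alpha>. {u \<alpha>, v \<alpha>}). i \<in> f}"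
    by auto
  also have "card \<dots> = card {j. {i, j} \<in> range (\<lambda>\<alpha>. {u \<alpha>, v \<alpha>})}"
    by (rule card_incident_edges[OF F])
  finally show ?thesis .
qed

text \<open>Rows \<open>i\<close> and \<open>j\<close> are both nonzero only at an index whose edge
  is {i, j}, and there the entries have opposite signs. By injectivity there is at most one such
  index.\<close>

lemma incidence_matrix_mult_transpose_off_diagonal:
  fixes u v :: "'p::finite \<Rightarrow> 'v::finite"
  assumes F: "range (\<lambda>\<alpha>. {u \<alpha>, v \<alpha>}) \<subseteq> complete_edges" and inj: "inj (\<lambda>\<alpha>. {u \<alpha>, v \<alpha>})"
    and "i \<noteq> j"
  shows "(incidence_matrix u v ** transpose (incidence_matrix u v)) $ i $ j =
    (if {i, j} \<in> range (\<lambda>\<alpha>. {u \<alpha>, v \<alpha>}) then - 1 else 0)"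
proof -
  have uv: "u \<alpha> \<noteq> v \<alpha>" for \<alpha>
    using F by (auto simp: complete_edges_def doubleton_eq_iff)
  have *: "(incidence_matrix u v ** transpose (incidence_matrix u v)) $ i $ j =
    (\<Sum>\<alpha>\<in>UNIV. if {i, j} = {u \<alpha>, v \<alpha>} then - 1 else 0)"
    unfolding matrix_matrix_mult_def transpose_def incidence_matrix_def
    using uv \<open>i \<noteq> j\<close> by (auto simp: axis_def doubleton_eq_iff intro!: sum.cong)
  show ?thesis
  proof (cases "{i, j} \<in> range (\<lambda>\<alpha>. {u \<alpha>, v \<alpha>})")
    case True
    then obtain \<beta> where \<beta>: "{i, j} = {u \<beta>, v \<beta>}"
      by auto
    have "{i, j} = {u \<alpha>, v \<alpha>} \<longleftrightarrow> \<alpha> = \<beta>" for \<alpha>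
      unfolding \<beta> using inj_eq[OF inj, of \<alpha> \<beta>] by (simp only: eq_commute[of "{u \<beta>, v \<beta>}"])
    then show ?thesis
      using True unfolding * by (simp only: sum.delta finite UNIV_I if_True)
  next
    case False
    then show ?thesis
      unfolding * by (subst sum.neutral) auto
  qed
qed

text \<open>Entrywise comparison. On the diagonal, the n - 1 vertices other than \<open>i\<close>
  split into neighbours in G and neighbours along F. Off the diagonal, the -1 from -J is cancelled
  exactly at the deleted edges.\<close>

lemma laplacian_matrix_complement:
  fixes u v :: "'p::finite \<Rightarrow> 'v::finite"
  defines "B \<equiv> incidence_matrix u v" and "F \<equiv> range (\<lambda>\<alpha>. {u \<alpha>, v \<alpha>})"
  assumes F: "F \<subseteq> complete_edges" and inj: "inj (\<lambda>\<alpha>. {u \<alpha>, v \<alpha>})"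
  shows "laplacian_matrix (complete_edges - F) =
    real CARD('v) *\<^sub>R mat 1 - ones_matrix - B ** transpose B"
proof -
  have complete: "{i, j} \<in> complete_edges \<longleftrightarrow> i \<noteq> j" for i j :: 'v
    by (auto simp: complete_edges_def doubleton_eq_iff)
  have "laplacian_matrix (complete_edges - F) $ i $ j =
    (real CARD('v) *\<^sub>R mat 1 - ones_matrix - B ** transpose B) $ i $ j" for i j
  proof (cases "i = j")
    case True
    have "{i, i} \<notin> F"
      using F complete[of i i] by blast
    then have "{k. {i, k} \<in> complete_edges - F} \<union> {k. {i, k} \<in> F} = UNIV - {i}"
      using F complete by blast
    moreover have "card ({k. {i, k} \<in> complete_edges - F} \<union> {k. {i, k} \<in> F}) =
        card {k. {i, k} \<in> complete_edges - F} + card {k. {i, k} \<in> F}"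
      by (rule card_Un_disjoint) auto
    \<comment> \<open>The successor accounts for \<open>i\<close> itself, a neighbour of neither
      kind.\<close>
    ultimately have "Suc (card {k. {i, k} \<in> complete_edges - F} + card {k. {i, k} \<in> F}) = CARD('v)"
      by (metis UNIV_I card_Suc_Diff1 finite)
    then have "real (card {k. {i, k} \<in> complete_edges - F}) =
        real CARD('v) - 1 - real (card {k. {i, k} \<in> F})"
      by linarith
    moreover have "card {e \<in> complete_edges - F. i \<in> e} = card {k. {i, k} \<in> complete_edges - F}"
      by (rule card_incident_edges) auto
    moreover have "(B ** transpose B) $ i $ i = card {k. {i, k} \<in> F}"
      unfolding B_def F_def
      by (rule incidence_matrix_mult_transpose_diagonal[OF F[unfolded F_def] inj])
    \<comment> \<open>The diagonal adjacency entry tests {i, i}, which is the singleton {i}.\<close>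
    moreover have "{i} \<notin> complete_edges"
      using complete[of i i] by simp
    ultimately show ?thesis
      using True
      by (simp add: laplacian_matrix_def degree_matrix_def adjacency_matrix_def mat_def)
  next
    case False
    then show ?thesis
      using incidence_matrix_mult_transpose_off_diagonal[OF F[unfolded F_def] inj False]
      by (simp add: laplacian_matrix_def degree_matrix_def adjacency_matrix_def mat_def complete
          B_def F_def)
  qed
  then show ?thesis
    by (simp add: vec_eq_iff)
qed

text \<open>For a square matrix a trivial kernel suffices. Connectedness enters only through the
  kernel of the Laplacian.\<close>

lemma invertible_complement:
  fixes u v :: "'p::finite \<Rightarrow> 'v::finite"
  defines "B \<equiv> incidence_matrix u v" and "F \<equiv> range (\<lambda>\<alpha>. {u \<alpha>, v \<alpha>})"
  assumes F: "F \<subseteq> complete_edges" and inj: "inj (\<lambda>\<alpha>. {u \<alpha>, v \<alpha>})"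
    and conn: "graph_connected (complete_edges - F)"
  shows "invertible (real CARD('v) *\<^sub>R mat 1 - transpose B ** B)"
proof -
  let ?n = "real CARD('v)"
  have "z = 0" if z: "(?n *\<^sub>R mat 1 - transpose B ** B) *v z = 0" for z
  proof -
    have nz: "transpose B *v (B *v z) = ?n *\<^sub>R z"
      using z by (simp add: algebra_simps scaleR_matrix_vector_assoc[symmetric] matrix_vector_mul_assoc
          del: transpose_matrix_vector)
    have JBz: "(ones_matrix :: real ^ 'v ^ 'v) *v (B *v z) = 0"
      by (simp add: matrix_vector_mul_assoc B_def ones_matrix_mult_incidence_matrix)
    have "laplacian_matrix (complete_edges - F) *v (B *v z) =
        ?n *\<^sub>R (B *v z) - B *v (transpose B *v (B *v z))"
      unfolding F_def laplacian_matrix_complement[OF F[unfolded F_def] inj] B_def[symmetric]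
      by (simp add: matrix_vector_mult_diff_rdistrib JBz scaleR_matrix_vector_assoc[symmetric]
          matrix_vector_mul_assoc[of B "transpose B", symmetric] del: transpose_matrix_vector)
    also have "\<dots> = 0"
      unfolding nz by (simp add: matrix_vector_mult_scaleR)
    finally have const: "(B *v z) $ i = (B *v z) $ j" for i j
      using laplacian_matrix_kernel_constant[OF _ conn] by blast
    \<comment> \<open>Every entry of J (B z) is this sum.\<close>
    have "(\<Sum>j\<in>UNIV. (B *v z) $ j) = 0"
      using JBz by (simp add: vec_eq_iff matrix_vector_mult_def[of ones_matrix])
    moreover have "(\<Sum>j\<in>UNIV. (B *v z) $ j) = ?n * (B *v z) $ i" for i
    proof -
      have "(\<Sum>j\<in>UNIV. (B *v z) $ j) = (\<Sum>j\<in>(UNIV :: 'v set). (B *v z) $ i)"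
        by (rule sum.cong[OF refl const])
      then show ?thesis
        by simp
    qed
    ultimately have "B *v z = 0"
      by (simp add: vec_eq_iff)
    \<comment> \<open>Now n z = B^T (B z) = 0 with n positive.\<close>
    with nz show ?thesis
      by simp
  qed
  then show ?thesis
    by (simp add: invertible_left_inverse matrix_left_invertible_ker)
qed

text \<open>The injective \<open>e\<close> lists the deleted edges, and \<open>u\<close>,
  \<open>v\<close> fix an arbitrary orientation; p is at least 1 because types are nonempty.
  Invertibility is asserted as well, so that \<open>matrix_inv\<close> denotes a genuine
  inverse.\<close>

theorem theorem3p1:
  fixes F :: "'v::finite edges"
    and e :: "'p::finite \<Rightarrow> 'v set"
    and u v :: "'p \<Rightarrow> 'v"
    and B :: "real ^ 'p ^ 'v"
    and Q :: "real ^ 'p ^ 'p"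
    and \<eta> :: "real ^ 'p"
    and n :: real
    and x y :: 'v
  assumes "F \<subseteq> complete_edges"
    and "F = range e" and "inj e"
    and "\<And>\<alpha>. e \<alpha> = {u \<alpha>, v \<alpha>}"
    and "graph_connected (complete_edges - F)"
    and "B = incidence_matrix u v"
    and "Q = edge_defect_matrix B"
    and "x \<noteq> y"
    and "\<eta> = transpose B *v (axis x 1 - axis y 1)"
    and "n = real CARD('v)"
  shows "invertible (n *\<^sub>R mat 1 - Q) \<and>
    effective_resistance (complete_edges - F) x y =
      2 / n + (1 / n) * (\<eta> \<bullet> (matrix_inv (n *\<^sub>R mat 1 - Q) *v \<eta>))"
proof -
  have e: "e = (\<lambda>\<alpha>. {u \<alpha>, v \<alpha>})"
    using assms(4) by auto
  have inj: "inj (\<lambda>\<alpha>. {u \<alpha>, v \<alpha>})" and F: "range (\<lambda>\<alpha>. {u \<alpha>, v \<alpha>}) \<subseteq> complete_edges"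
    using assms(1-3) by (simp_all add: e)
  define K where "K = n *\<^sub>R mat 1 - Q"
  have K: "K = real CARD('v) *\<^sub>R mat 1 - transpose B ** B"
    by (simp add: K_def assms edge_defect_matrix_def)
  have inv: "invertible K"
    using invertible_complement[OF F inj] assms(5) by (simp add: K assms(2,6) e)
  define S where "S = matrix_inv K"
  \<comment> \<open>\<open>matrix_inv\<close> is a choice; invertibility guarantees that the chosen
    matrix is a two-sided inverse.\<close>
  have KS: "K ** S = mat 1" and SK: "S ** K = mat 1"
    using inv someI_ex[of "\<lambda>A'. K ** A' = mat 1 \<and> A' ** K = mat 1"]
    by (auto simp: S_def matrix_inv_def invertible_def)
  define d :: "real ^ 'v" where "d = axis x 1 - axis y 1"
  have JB: "(ones_matrix :: real ^ 'v ^ 'v) ** B = 0"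
    by (simp add: assms(6) ones_matrix_mult_incidence_matrix)
  have "is_moore_penrose_inverse (laplacian_matrix (complete_edges - F))
    ((1 / n) *\<^sub>R (mat 1 - (1 / n) *\<^sub>R ones_matrix + B ** S ** transpose B))"
    using is_moore_penrose_inverse_complement[OF JB KS[unfolded K] SK[unfolded K]]
      laplacian_matrix_complement[OF F inj] by (simp add: assms(2,6,10) e)
  then have mp: "moore_penrose_inverse (laplacian_matrix (complete_edges - F)) =
    (1 / n) *\<^sub>R (mat 1 - (1 / n) *\<^sub>R ones_matrix + B ** S ** transpose B)"
    by (rule moore_penrose_inverse_eqI)
  \<comment> \<open>In the quadratic form at \<open>d\<close> the J term vanishes, I contributes d.d
    = 2 because \<open>x\<close> and \<open>y\<close> differ, and B S B^T contributes the form of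
    \<open>S\<close> at B^T d, which is \<eta>.\<close>
  have Jd: "(ones_matrix :: real ^ 'v ^ 'v) *v d = 0"
    by (simp add: d_def matrix_vector_mult_def vec_eq_iff axis_def right_diff_distrib sum_subtractf)
  have dd: "d \<bullet> d = 2"
    using assms(8) by (simp add: d_def inner_diff_left inner_diff_right inner_axis_axis)
  have "d \<bullet> ((B ** S ** transpose B) *v d) = d \<bullet> (B *v (S *v \<eta>))"
    by (simp only: matrix_vector_mul_assoc[symmetric] assms(9) d_def)
  also have "\<dots> = \<eta> \<bullet> (S *v \<eta>)"
    by (simp add: assms(9) d_def[symmetric] dot_lmul_matrix)
  finally have "d \<bullet> (((1 / n) *\<^sub>R (mat 1 - (1 / n) *\<^sub>R ones_matrix + B ** S ** transpose B)) *v d) =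
    2 / n + (1 / n) * (\<eta> \<bullet> (S *v \<eta>))"
    by (simp add: scaleR_matrix_vector_assoc[symmetric] matrix_vector_mult_add_rdistrib
        matrix_vector_mult_diff_rdistrib Jd inner_add_right dd add_divide_distrib)
  then show ?thesis
    using inv by (simp add: effective_resistance_def mp d_def S_def K_def)
qed

end
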